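(* Let $0<s<1$, $1<p<\infty$, let $\Omega\subset\mathbb{R}^n$ be a bounded domain, $f\in L^\infty(\Omega)$, and $g\in C(\mathbb{R}^n)\cap L^\infty(\mathbb{R}^n)$. If $x_0\in\mathbb{R}^n\setminus\overline\Omega$, then $$\lim_{x\to x_0}\overline{\mathfrak h}_g(x)=g(x_0),$$ and the same holds for the lower solution: $\lim_{x\to x_0}\underline{\mathfrak h}_g(x)=g(x_0)$.
   Context: Operator: $\mathcal{L}_p^s u(x)=2\,\mathrm{PV}\int_{\mathbb{R}^n}\frac{|u(y)-u(x)|^{p-2}(u(y)-u(x))}{|y-x|^{n+sp}}\,dy$; the equation is $\mathcal{L}_p^su=-f$ in $\Omega$. $W^{s,p}_{loc}(\Omega)$ is the set of functions $u$ with $\int_K\int_K\frac{|u(x)-u(y)|^p}{|x-y|^{n+sp}}dxdy+\int_K|u|^pdx<\infty$ for every open $K\subset\subset\Omega$. A local weak solution of $\mathcal{L}_p^su=-f$ in an open set $D$ is a function $u\in W^{s,p}_{loc}(D)\cap L^\infty(\mathbb{R}^n)$ with $\int_{\mathbb{R}^n}\int_{\mathbb{R}^n}\frac{|u(x)-u(y)|^{p-2}(u(x)-u(y))(\phi(x)-\phi(y))}{|x-y|^{n+sp}}dxdy=\int_D f\phi\,dx$ for all $\phi\in C_0^\infty(D)$. Local weak solutions are always taken continuous in $D$ (after modification on a null set). Comparison principle: a lower semicontinuous $v$ satisfies the comparison principle from above in $\Omega$ (for $\mathcal{L}_p^s v=-f$) if, whenever $D\subset\subset\Omega$ is a subdomain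 and $h\in C(\overline D)$ is a local weak solution of $\mathcal{L}_p^sh=-f$ in $D$ with $h\le v$ in $\mathbb{R}^n\setminus D$ and $h(\xi)\le\liminf_{x\to\xi}v(x)$ for all $\xi\in\partial D$, then $h\le v$. An upper semicontinuous $u$ satisfies the comparison principle from below if the analogous statement with reversed inequalities (and $\limsup$) holds. Upper class $\mathscr{U}_g$: all $v:\mathbb{R}^n\to(-\infty,\infty]$ such that (i) $v$ is lower semicontinuous and obeys the comparison principle from above in $\Omega$; (ii) $\liminf_{x\to\xi}v(x)\ge g(\xi)$ for $\xi\in\partial\Omega$; (iii) $v\ge g$ in $\mathbb{R}^n\setminus\Omega$. Lower class $\mathscr{L}_g$: all $u:\mathbb{R}^n\to[-\infty,\infty)$ such that (i) $u$ is upper semicontinuous and obeys the comparison principle from below in $\Omega$; (ii) $\limsup_{x\to\xi}u(x)\le g(\xi)$ for $\xi\in\partial\Omega$; (iii) $u\le g$ in $\mathbb{R}^n\setminus\Omega$. Perron solutions: for $x\in\mathbb{R}^n$, $\overline{\mathfrak h}_g(x)=\inf_{v\in\mathscr{U}_g}v(x)$ and $\underline{\mathfrak h}_g(x)=\sup_{u\in\mathscr{L}_g}u(x)$. *)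

theory Defs
  imports "HOL-Analysis.Analysis"
begin

definition is_domain :: "'a::euclidean_space set \<Rightarrow> bool" where
  "is_domain D \<longleftrightarrow> open D \<and> connected D \<and> D \<noteq> {}"

definition compactly_inside :: "'a::euclidean_space set \<Rightarrow> 'a set \<Rightarrow> bool" (infix "\<subset>\<subset>" 50) where
  "K \<subset>\<subset> S \<longleftrightarrow> compact (closure K) \<and> closure K \<subseteq> S"

definition L_infty :: "'a::euclidean_space set \<Rightarrow> ('a \<Rightarrow> real) \<Rightarrow> bool" where
  "L_infty S u \<longleftrightarrow>
     u \<in> borel_measurable (lebesgue_on S) \<and> (\<exists>C. AE x in lebesgue_on S. \<bar>u x\<bar> \<le> C)"

definition Wsp_loc :: "real \<Rightarrow> real \<Rightarrow> 'a::euclidean_space set \<Rightarrow> ('a \<Rightarrow> real) \<Rightarrow> bool" where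
  "Wsp_loc s p S u \<longleftrightarrow>
     u \<in> borel_measurable (lebesgue_on S) \<and>
     (\<forall>K. open K \<and> K \<subset>\<subset> S \<longrightarrow>
        (\<integral>\<^sup>+x. (\<integral>\<^sup>+y. ennreal (\<bar>u x - u y\<bar> powr p / norm (x - y) powr (real DIM('a) + s * p))
           \<partial>lebesgue_on K) \<partial>lebesgue_on K)
        + (\<integral>\<^sup>+x. ennreal (\<bar>u x\<bar> powr p) \<partial>lebesgue_on K) < \<infinity>)"

text \<open>\<^term>\<open>Ck k \<phi>\<close>: all iterated directional derivatives of order at most \<open>k\<close> exist and are
  continuous on the whole space.\<close>

primrec Ck :: "nat \<Rightarrow> ('a::euclidean_space \<Rightarrow> real) \<Rightarrow> bool" where
  "Ck 0 \<phi> \<longleftrightarrow> continuous_on UNIV \<phi>"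
| "Ck (Suc k) \<phi> \<longleftrightarrow>
     (\<forall>x. \<phi> differentiable (at x)) \<and> (\<forall>v. Ck k (\<lambda>x. frechet_derivative \<phi> (at x) v))"

definition test_function :: "'a::euclidean_space set \<Rightarrow> ('a \<Rightarrow> real) \<Rightarrow> bool" where
  "test_function D \<phi> \<longleftrightarrow> (\<forall>k. Ck k \<phi>) \<and> {x. \<phi> x \<noteq> 0} \<subset>\<subset> D"

text \<open>The weak form of \<open>\<L>\<^sub>p\<^sup>s u = -f\<close> in \<open>D\<close>. The double integral is the Lebesgue integral over the
  product space; \<^const>\<open>has_bochner_integral\<close> asserts that it converges absolutely (which holds for
  every locally \<open>W\<^sup>s\<^sup>,\<^sup>p\<close>, bounded \<open>u\<close>) and gives its value. At \<open>u x = u y\<close> the factor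
  \<open>0 powr (p - 2) * 0\<close> is \<open>0\<close>, as it should be also for \<open>p < 2\<close>. A solution is identified with its
  continuous representative in \<open>D\<close>; outside \<open>D\<close> its pointwise values are kept.\<close>

definition local_weak_solution ::
    "real \<Rightarrow> real \<Rightarrow> ('a::euclidean_space \<Rightarrow> real) \<Rightarrow> 'a set \<Rightarrow> ('a \<Rightarrow> real) \<Rightarrow> bool" where
  "local_weak_solution s p f D u \<longleftrightarrow>
     Wsp_loc s p D u \<and> L_infty UNIV u \<and> continuous_on D u \<and>
     (\<forall>\<phi>. test_function D \<phi> \<longrightarrow>
        has_bochner_integral (lebesgue :: ('a \<times> 'a) measure)
          (\<lambda>(x, y). \<bar>u x - u y\<bar> powr (p - 2) * (u x - u y) * (\<phi> x - \<phi> y)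
                      / norm (x - y) powr (real DIM('a) + s * p))
          (\<integral>x. f x * \<phi> x \<partial>lebesgue_on D))"

definition lower_semicontinuous :: "('a::euclidean_space \<Rightarrow> ereal) \<Rightarrow> bool" where
  "lower_semicontinuous v \<longleftrightarrow> (\<forall>x. v x \<le> Liminf (at x) v)"

definition upper_semicontinuous :: "('a::euclidean_space \<Rightarrow> ereal) \<Rightarrow> bool" where
  "upper_semicontinuous u \<longleftrightarrow> (\<forall>x. Limsup (at x) u \<le> u x)"

definition comparison_from_above ::
    "real \<Rightarrow> real \<Rightarrow> ('a::euclidean_space \<Rightarrow> real) \<Rightarrow> 'a set \<Rightarrow> ('a \<Rightarrow> ereal) \<Rightarrow> bool" where
  "comparison_from_above s p f \<Omega> v \<longleftrightarrow>
     (\<forall>D h. is_domain D \<and> D \<subset>\<subset> \<Omega> \<and>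
            continuous_on (closure D) h \<and> local_weak_solution s p f D h \<and>
            (\<forall>x. x \<notin> D \<longrightarrow> ereal (h x) \<le> v x) \<and>
            (\<forall>\<xi>\<in>frontier D. ereal (h \<xi>) \<le> Liminf (at \<xi>) v)
        \<longrightarrow> (\<forall>x. ereal (h x) \<le> v x))"

definition comparison_from_below ::
    "real \<Rightarrow> real \<Rightarrow> ('a::euclidean_space \<Rightarrow> real) \<Rightarrow> 'a set \<Rightarrow> ('a \<Rightarrow> ereal) \<Rightarrow> bool" where
  "comparison_from_below s p f \<Omega> u \<longleftrightarrow>
     (\<forall>D h. is_domain D \<and> D \<subset>\<subset> \<Omega> \<and>
            continuous_on (closure D) h \<and> local_weak_solution s p f D h \<and>
            (\<forall>x. x \<notin> D \<longrightarrow> u x \<le> ereal (h x)) \<and>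
            (\<forall>\<xi>\<in>frontier D. Limsup (at \<xi>) u \<le> ereal (h \<xi>))
        \<longrightarrow> (\<forall>x. u x \<le> ereal (h x)))"

definition upper_class ::
    "real \<Rightarrow> real \<Rightarrow> ('a::euclidean_space \<Rightarrow> real) \<Rightarrow> 'a set \<Rightarrow> ('a \<Rightarrow> real) \<Rightarrow> ('a \<Rightarrow> ereal) set" where
  "upper_class s p f \<Omega> g =
     {v. (\<forall>x. v x \<noteq> -\<infinity>) \<and>
         lower_semicontinuous v \<and> comparison_from_above s p f \<Omega> v \<and>
         (\<forall>\<xi>\<in>frontier \<Omega>. ereal (g \<xi>) \<le> Liminf (at \<xi>) v) \<and>
         (\<forall>x. x \<notin> \<Omega> \<longrightarrow> ereal (g x) \<le> v x)}"

definition lower_class ::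
    "real \<Rightarrow> real \<Rightarrow> ('a::euclidean_space \<Rightarrow> real) \<Rightarrow> 'a set \<Rightarrow> ('a \<Rightarrow> real) \<Rightarrow> ('a \<Rightarrow> ereal) set" where
  "lower_class s p f \<Omega> g =
     {u. (\<forall>x. u x \<noteq> \<infinity>) \<and>
         upper_semicontinuous u \<and> comparison_from_below s p f \<Omega> u \<and>
         (\<forall>\<xi>\<in>frontier \<Omega>. Limsup (at \<xi>) u \<le> ereal (g \<xi>)) \<and>
         (\<forall>x. x \<notin> \<Omega> \<longrightarrow> u x \<le> ereal (g x))}"

definition upper_perron ::
    "real \<Rightarrow> real \<Rightarrow> ('a::euclidean_space \<Rightarrow> real) \<Rightarrow> 'a set \<Rightarrow> ('a \<Rightarrow> real) \<Rightarrow> 'a \<Rightarrow> ereal" where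
  "upper_perron s p f \<Omega> g x = (INF v\<in>upper_class s p f \<Omega> g. v x)"

definition lower_perron ::
    "real \<Rightarrow> real \<Rightarrow> ('a::euclidean_space \<Rightarrow> real) \<Rightarrow> 'a set \<Rightarrow> ('a \<Rightarrow> real) \<Rightarrow> 'a \<Rightarrow> ereal" where
  "lower_perron s p f \<Omega> g x = (SUP u\<in>lower_class s p f \<Omega> g. u x)"

end

(* The classes are large: the function equal to g off \<Omega> and to \<infinity> on \<Omega> belongs to the upper
   class, because its comparison with any h inside \<Omega> is vacuous and it is lower semicontinuous as
   \<Omega> is open and g is continuous. Hence the upper Perron solution equals g off \<Omega>, and
   dually for the lower one; the limits at exterior points are then the continuity of g. *)
theory Submission imports Defs begin

lemma tendsto_ereal_continuous:
  fixes g :: "'a::euclidean_space \<Rightarrow> real"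
  assumes "continuous_on UNIV g"
  shows "((\<lambda>y. ereal (g y)) \<longlongrightarrow> ereal (g x)) (at x)"
  using assms by (simp add: continuous_on_def)

text \<open>The complement of the closure is open, so a point of it has a whole neighbourhood off
  \<Omega>. This turns pointwise equality off \<Omega> into equality near an exterior point.\<close>

lemma eventually_at_in_complement_closure:
  fixes \<Omega> :: "'a::euclidean_space set"
  assumes "x \<notin> closure \<Omega>"
  shows "\<forall>\<^sub>F y in at x. y \<notin> \<Omega>"
proof -
  have "\<forall>\<^sub>F y in at x. y \<in> - closure \<Omega>"
    using assms by (intro eventually_at_in_open') auto
  then show ?thesis
    by eventually_elim (use closure_subset in auto)
qed

lemma infinite_extension_in_upper_class:
  fixes g :: "'a::euclidean_space \<Rightarrow> real"
  assumes "open \<Omega>" "continuous_on UNIV g"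
  defines "v \<equiv> \<lambda>x. if x \<in> \<Omega> then \<infinity> else ereal (g x)"
  shows "v \<in> upper_class s p f \<Omega> g"
proof -
  \<comment> \<open>Since \<open>v\<close> dominates \<open>g\<close> everywhere, this bound holds
    at every point. It serves twice: as the boundary condition on the frontier, and as lower
    semicontinuity off \<Omega>, where \<open>v\<close> equals \<open>g\<close>.\<close>
  have Liminf_ge: "ereal (g x) \<le> Liminf (at x) v" for x
  proof -
    have "ereal (g x) = Liminf (at x) (\<lambda>y. ereal (g y))"
      \<comment> \<open>A Euclidean space has no isolated points, so the filter \<open>at x\<close>
        is proper and the limit is also the lower limit.\<close>
      by (rule lim_imp_Liminf[OF trivial_limit_at tendsto_ereal_continuous[OF assms(2)], symmetric])
    also have "\<dots> \<le> Liminf (at x) v"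
      by (intro Liminf_mono always_eventually) (simp add: v_def)
    finally show ?thesis .
  qed
  have "v x \<le> Liminf (at x) v" for x
  proof (cases "x \<in> \<Omega>")
    case True
    have "\<forall>\<^sub>F y in at x. y \<in> \<Omega>"
      using assms(1) True by (rule eventually_at_in_open')
    then have "\<forall>\<^sub>F y in at x. \<infinity> \<le> v y"
      by eventually_elim (simp add: v_def)
    then have "\<infinity> \<le> Liminf (at x) v"
      by (rule Liminf_bounded)
    then show ?thesis by simp
  qed (use Liminf_ge in \<open>simp add: v_def\<close>)
  \<comment> \<open>Points of \<open>D\<close> lie in its closure, hence in \<Omega>, where
    \<open>v\<close> is infinite; off \<open>D\<close> the inequality is what is assumed of
    \<open>h\<close>.\<close>
  moreover have "comparison_from_above s p f \<Omega> v"
    unfolding comparison_from_above_def compactly_inside_def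
    using closure_subset by (fastforce simp: v_def)
  ultimately show ?thesis
    using Liminf_ge by (simp add: upper_class_def lower_semicontinuous_def) (simp add: v_def)
qed

text \<open>The order-reversed argument: the value -\<infinity> on \<Omega> lies below every
  \<open>h\<close>, and the lower class admits it because only +\<infinity> is excluded
  there.\<close>

lemma infinite_extension_in_lower_class:
  fixes g :: "'a::euclidean_space \<Rightarrow> real"
  assumes "open \<Omega>" "continuous_on UNIV g"
  defines "u \<equiv> \<lambda>x. if x \<in> \<Omega> then -\<infinity> else ereal (g x)"
  shows "u \<in> lower_class s p f \<Omega> g"
proof -
  have Limsup_le: "Limsup (at x) u \<le> ereal (g x)" for x
  proof -
    have "Limsup (at x) u \<le> Limsup (at x) (\<lambda>y. ereal (g y))"
      by (intro Limsup_mono always_eventually) (simp add: u_def)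
    also have "\<dots> = ereal (g x)"
      by (rule lim_imp_Limsup[OF trivial_limit_at tendsto_ereal_continuous[OF assms(2)]])
    finally show ?thesis .
  qed
  have "Limsup (at x) u \<le> u x" for x
  proof (cases "x \<in> \<Omega>")
    case True
    have "\<forall>\<^sub>F y in at x. y \<in> \<Omega>"
      using assms(1) True by (rule eventually_at_in_open')
    then have "\<forall>\<^sub>F y in at x. u y \<le> -\<infinity>"
      by eventually_elim (simp add: u_def)
    then have "Limsup (at x) u \<le> -\<infinity>"
      by (rule Limsup_bounded)
    then show ?thesis by simp
  qed (use Limsup_le in \<open>simp add: u_def\<close>)
  moreover have "comparison_from_below s p f \<Omega> u"
    unfolding comparison_from_below_def compactly_inside_def
    using closure_subset by (fastforce simp: u_def)
  ultimately show ?thesis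
    using Limsup_le by (simp add: lower_class_def upper_semicontinuous_def) (simp add: u_def)
qed

text \<open>Every member of the class is at least \<open>g\<close> off \<Omega>, and the infinite
  extension attains this bound, so the infimum is a minimum there.\<close>

lemma upper_perron_eq_outside:
  fixes g :: "'a::euclidean_space \<Rightarrow> real"
  assumes "open \<Omega>" "continuous_on UNIV g" "x \<notin> \<Omega>"
  shows "upper_perron s p f \<Omega> g x = ereal (g x)"
  unfolding upper_perron_def
proof (rule antisym)
  show "(INF v\<in>upper_class s p f \<Omega> g. v x) \<le> ereal (g x)"
    by (rule INF_lower2[OF infinite_extension_in_upper_class[OF assms(1,2)]])
      (simp add: assms(3))
  show "ereal (g x) \<le> (INF v\<in>upper_class s p f \<Omega> g. v x)"
    using assms(3) by (intro INF_greatest) (simp add: upper_class_def)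
qed

lemma lower_perron_eq_outside:
  fixes g :: "'a::euclidean_space \<Rightarrow> real"
  assumes "open \<Omega>" "continuous_on UNIV g" "x \<notin> \<Omega>"
  shows "lower_perron s p f \<Omega> g x = ereal (g x)"
  unfolding lower_perron_def
proof (rule antisym)
  show "ereal (g x) \<le> (SUP u\<in>lower_class s p f \<Omega> g. u x)"
    by (rule SUP_upper2[OF infinite_extension_in_lower_class[OF assms(1,2)]])
      (simp add: assms(3))
  show "(SUP u\<in>lower_class s p f \<Omega> g. u x) \<le> ereal (g x)"
    using assms(3) by (intro SUP_least) (simp add: lower_class_def)
qed

theorem proposition24:
  fixes s p :: real and \<Omega> :: "'a::euclidean_space set" and f g :: "'a \<Rightarrow> real" and x0 :: 'a
  assumes "0 < s" "s < 1" "1 < p"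
    and "is_domain \<Omega>" "bounded \<Omega>"
    and "L_infty \<Omega> f"
    and "continuous_on UNIV g" "L_infty UNIV g"
    and "x0 \<notin> closure \<Omega>"
  shows "(upper_perron s p f \<Omega> g \<longlongrightarrow> ereal (g x0)) (at x0) \<and>
         (lower_perron s p f \<Omega> g \<longlongrightarrow> ereal (g x0)) (at x0)"
proof -
  have "open \<Omega>"
    using assms(4) by (simp add: is_domain_def)
  note outside = eventually_at_in_complement_closure[OF assms(9)]
  \<comment> \<open>Agreement with \<open>g\<close> on a punctured neighbourhood of
    \<open>x0\<close> is enough to carry over the limit of \<open>g\<close>.\<close>
  have "\<forall>\<^sub>F y in at x0. ereal (g y) = upper_perron s p f \<Omega> g y"
    using outside by eventually_elim (simp add: upper_perron_eq_outside \<open>open \<Omega>\<close> assms(7))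
  moreover have "\<forall>\<^sub>F y in at x0. ereal (g y) = lower_perron s p f \<Omega> g y"
    using outside by eventually_elim (simp add: lower_perron_eq_outside \<open>open \<Omega>\<close> assms(7))
  ultimately show ?thesis
    using tendsto_ereal_continuous[OF assms(7)] by (blast intro: Lim_transform_eventually)
qed

end
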